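(* Every positive integer $n\equiv 1\pmod 5$ that is a sum of three squares of integers is a sum of three nonunit squares, except for $n=1,6,11,21,26,46,51,91$.
   Context: A positive integer $n$ is called a sum of three nonunit squares if there exist integers $x,y,z$ with $n=x^2+y^2+z^2$ and $(x^2-1)(y^2-1)(z^2-1)\neq 0$ (zero is allowed as a value of $x,y,z$). *)

theory Defs
  imports Complex_Main "HOL-Number_Theory.Cong"
begin

definition sum_of_three_squares :: "int \<Rightarrow> bool" where
  "sum_of_three_squares n \<longleftrightarrow> (\<exists>x y z :: int. n = x\<^sup>2 + y\<^sup>2 + z\<^sup>2)"

definition sum_of_three_nonunit_squares :: "int \<Rightarrow> bool" where
  "sum_of_three_nonunit_squares n \<longleftrightarrow>
     (\<exists>x y z :: int. n = x\<^sup>2 + y\<^sup>2 + z\<^sup>2 \<and> (x\<^sup>2 - 1) * (y\<^sup>2 - 1) * (z\<^sup>2 - 1) \<noteq> 0)"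

end

theory Submission
  imports Defs
begin

text \<open>
  If \<open>n = 1 + y\<^sup>2 + z\<^sup>2\<close> with \<open>5\<close> dividing \<open>y\<^sup>2 + z\<^sup>2 > 0\<close>, multiplying \<open>y + z i\<close> by powers of
  \<open>(2 + i) / (2 - i)\<close> reaches a representation with \<open>y \<equiv> \<plusminus>1\<close> and \<open>z \<equiv> \<plusminus>2\<close> modulo \<open>5\<close>. Now the rational
  rotation of denominator \<open>5\<close> is integral on \<open>(1, z)\<close>, and it removes the unit unless
  \<open>\<bar>y\<bar> = 1\<close> or \<open>\<bar>z\<bar> \<in> {2, 3}\<close>. In these cases reflection in a vector \<open>(\<plusminus>1, \<plusminus>1, \<plusminus>1)\<close> works,
  except for \<open>n = 10 + (3 s)\<^sup>2\<close>. There \<open>1 + s i = (e + f i) (a + b i)\<close> with \<open>e\<^sup>2 + f\<^sup>2 = 5 ^ k\<close> and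
  \<open>a\<^sup>2 + b\<^sup>2\<close> prime to \<open>5\<close>; conjugating the second factor only gives another representation of
  \<open>1 + s\<^sup>2\<close>, to which the rotation applies, unless \<open>a\<^sup>2 + b\<^sup>2 \<in> {1, 2}\<close>. The equations
  \<open>s\<^sup>2 + 1 = 5 ^ k\<close> and \<open>s\<^sup>2 + 1 = 2 * 5 ^ k\<close> are negative Pell equations in which the second
  unknown is a power of \<open>5\<close>, and for large \<open>k\<close> that unknown acquires a prime factor other than \<open>5\<close>.
\<close>

section \<open>Nonunit representations and the exceptional values\<close>

lemma sum_of_three_nonunit_squaresI:
  fixes x y z :: int
  assumes "n = x\<^sup>2 + y\<^sup>2 + z\<^sup>2" "\<bar>x\<bar> \<noteq> 1" "\<bar>y\<bar> \<noteq> 1" "\<bar>z\<bar> \<noteq> 1"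
  shows "sum_of_three_nonunit_squares n"
  unfolding sum_of_three_nonunit_squares_def
  using assms by (intro exI[of _ x] exI[of _ y] exI[of _ z]) (auto simp: power2_eq_1_iff)

lemma power2_eq_1_of_abs:
  fixes w :: int
  shows "\<bar>w\<bar> = 1 \<Longrightarrow> w\<^sup>2 = 1"
  by (metis power2_abs one_power2)

lemma not_sum_of_three_nonunit_squares:
  assumes "n \<in> {1, 6, 11, 21, 26, 46, 51, 91}"
  shows "\<not> sum_of_three_nonunit_squares n"
proof
  assume "sum_of_three_nonunit_squares n"
  then obtain x y z :: int where n: "n = x\<^sup>2 + y\<^sup>2 + z\<^sup>2"
    and nz: "x\<^sup>2 \<noteq> 1" "y\<^sup>2 \<noteq> 1" "z\<^sup>2 \<noteq> 1"
    unfolding sum_of_three_nonunit_squares_def by auto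
  have sq: "u\<^sup>2 \<in> {0, 4, 9, 16, 25, 36, 49, 64, 81}" if "u\<^sup>2 \<le> 91" "u\<^sup>2 \<noteq> 1" for u :: int
  proof -
    have "\<bar>u\<bar> < 10"
      by (rule power2_less_imp_less) (use that in auto)
    then have "\<bar>u\<bar> \<in> {0, 1, 2, 3, 4, 5, 6, 7, 8, 9}" by simp presburger
    then have "\<bar>u\<bar>\<^sup>2 \<in> {0, 1, 4, 9, 16, 25, 36, 49, 64, 81}" by (elim insertE) auto
    then show ?thesis using that(2) by simp
  qed
  have "x\<^sup>2 + y\<^sup>2 + z\<^sup>2 \<le> 91" using assms n by auto
  moreover have "x\<^sup>2 \<ge> 0" "y\<^sup>2 \<ge> 0" "z\<^sup>2 \<ge> 0" by auto
  ultimately have "x\<^sup>2 \<le> 91" "y\<^sup>2 \<le> 91" "z\<^sup>2 \<le> 91" by linarith+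
  then have in_squares: "x\<^sup>2 \<in> {0, 4, 9, 16, 25, 36, 49, 64, 81}"
    "y\<^sup>2 \<in> {0, 4, 9, 16, 25, 36, 49, 64, 81}" "z\<^sup>2 \<in> {0, 4, 9, 16, 25, 36, 49, 64, 81}"
    using nz by - (rule sq, assumption, assumption)+
  have "\<forall>u\<in>{0, 4, 9, 16, 25, 36, 49, 64, 81}. \<forall>v\<in>{0, 4, 9, 16, 25, 36, 49, 64, 81}.
      \<forall>w\<in>{0, 4, 9, 16, 25, 36, 49, 64, 81}. u + v + w \<notin> {1, 6, 11, 21, 26, 46, 51, 91 :: int}"
    by simp
  from this[THEN bspec, OF in_squares(1), THEN bspec, OF in_squares(2), THEN bspec, OF in_squares(3)]
  show False using assms unfolding n by contradiction
qed

subsection \<open>Sums of two squares modulo 5\<close>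

text \<open>Since -1 = 2^2 modulo 5, the form splits into two linear factors modulo 5.\<close>

lemma five_dvd_sum_two_squares_iff:
  fixes y z :: int
  shows "5 dvd y\<^sup>2 + z\<^sup>2 \<longleftrightarrow> 5 dvd y - 2 * z \<or> 5 dvd y + 2 * z"
proof -
  have "y\<^sup>2 + z\<^sup>2 = (y - 2 * z) * (y + 2 * z) + 5 * z\<^sup>2"
    by (simp add: algebra_simps power2_eq_square)
  then have "5 dvd y\<^sup>2 + z\<^sup>2 \<longleftrightarrow> 5 dvd (y - 2 * z) * (y + 2 * z)"
    by (metis dvd_add_left_iff dvd_triv_left)
  moreover have "prime (5 :: int)" by simp
  ultimately show ?thesis by (metis prime_dvd_mult_iff)
qed

lemma sum_two_squares_residues_mod5:
  fixes y z :: int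
  assumes "5 dvd y\<^sup>2 + z\<^sup>2" "\<not> (5 dvd y \<and> 5 dvd z)"
  shows "y mod 5 \<in> {1, 4} \<and> z mod 5 \<in> {2, 3} \<or> z mod 5 \<in> {1, 4} \<and> y mod 5 \<in> {2, 3}"
  using assms unfolding five_dvd_sum_two_squares_iff by simp presburger

lemma sum_two_squares_not_both_dvd5:
  fixes y z :: int
  assumes "y\<^sup>2 + z\<^sup>2 > 0"
  shows "\<exists>u v :: int. u\<^sup>2 + v\<^sup>2 = y\<^sup>2 + z\<^sup>2 \<and> \<not> (5 dvd u \<and> 5 dvd v)"
  using assms
proof (induction "nat (y\<^sup>2 + z\<^sup>2)" arbitrary: y z rule: less_induct)
  case less
  show ?case
  proof (cases "5 dvd y \<and> 5 dvd z")
    case True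
    then obtain y' z' where yz: "y = 5 * y'" "z = 5 * z'" by (auto elim!: dvdE)
    have eq: "y\<^sup>2 + z\<^sup>2 = 25 * (y'\<^sup>2 + z'\<^sup>2)" by (simp add: yz algebra_simps)
    then have pos: "y'\<^sup>2 + z'\<^sup>2 > 0" using less.prems by simp
    then obtain u v where uv: "u\<^sup>2 + v\<^sup>2 = y'\<^sup>2 + z'\<^sup>2" "\<not> (5 dvd u \<and> 5 dvd v)"
      using less.hyps[of y' z'] eq by auto
    \<comment> \<open>These are (3 + 4i)(u - vi) and (3 + 4i)(u + vi), where 3 + 4i = (2 + i)^2 has
      norm 25. If 5 divided both first entries, it would divide 6u and 8v.\<close>
    have "(3 * u + 4 * v)\<^sup>2 + (4 * u - 3 * v)\<^sup>2 = y\<^sup>2 + z\<^sup>2"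
         "(3 * u - 4 * v)\<^sup>2 + (4 * u + 3 * v)\<^sup>2 = y\<^sup>2 + z\<^sup>2"
      unfolding eq uv(1)[symmetric] by (simp_all add: algebra_simps power2_eq_square)
    moreover have "\<not> 5 dvd 3 * u + 4 * v \<or> \<not> 5 dvd 3 * u - 4 * v"
      using uv(2) by presburger
    ultimately show ?thesis by blast
  qed auto
qed

text \<open>In the Gaussian integers \<open>5 dvd A - 2 * B\<close> says that 2 + i divides A + Bi,
  and then 5 not dividing B rules out the factor 2 - i. Dividing by 2 + i as long as possible leaves
  a + bi of norm prime to 5. Of e + fi = (2 + i)^k only the norm and residue conditions modulo 5 are
  recorded.\<close>

lemma gaussian_power_five_factor:
  fixes A B :: int
  assumes "5 dvd A - 2 * B" "\<not> 5 dvd B"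
  shows "\<exists>k e f a b. k \<ge> 1 \<and> e\<^sup>2 + f\<^sup>2 = 5 ^ k \<and> 5 dvd e - 2 * f \<and> \<not> 5 dvd f \<and>
           A = e * a - f * b \<and> B = e * b + f * a \<and> \<not> 5 dvd a\<^sup>2 + b\<^sup>2"
  using assms
proof (induction "nat (A\<^sup>2 + B\<^sup>2)" arbitrary: A B rule: less_induct)
  case less
  obtain c where c: "A = 2 * B + 5 * c" using less.prems(1) by (auto elim!: dvdE simp: algebra_simps)
  \<comment> \<open>a + bi is the quotient (A + Bi) / (2 + i).\<close>
  define a where "a = B + 2 * c"
  define b where "b = - c"
  have AB: "A = 2 * a - b" "B = 2 * b + a" by (simp_all add: c a_def b_def)
  show ?case
  proof (cases "5 dvd a\<^sup>2 + b\<^sup>2")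
    case False
    then show ?thesis
      using AB by (intro exI[of _ 1] exI[of _ 2] exI[of _ a] exI[of _ b]) auto
  next
    case True
    \<comment> \<open>B = a + 2b is prime to 5, so only the factor a - 2b can vanish modulo
      5.\<close>
    then have "5 dvd a - 2 * b" "\<not> 5 dvd b"
      using less.prems AB unfolding five_dvd_sum_two_squares_iff by presburger+
    moreover have "A\<^sup>2 + B\<^sup>2 = 5 * (a\<^sup>2 + b\<^sup>2)"
      by (simp add: AB algebra_simps power2_eq_square)
    moreover have "b \<noteq> 0" using \<open>\<not> 5 dvd b\<close> by auto
    then have "a\<^sup>2 + b\<^sup>2 > 0" by (simp add: add_nonneg_pos)
    ultimately obtain k e f a' b' where IH: "k \<ge> 1" "e\<^sup>2 + f\<^sup>2 = 5 ^ k" "5 dvd e - 2 * f"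
      "\<not> 5 dvd f" "a = e * a' - f * b'" "b = e * b' + f * a'" "\<not> 5 dvd a'\<^sup>2 + b'\<^sup>2"
      using less.hyps[of a b] by auto
    have "(2 * e - f)\<^sup>2 + (2 * f + e)\<^sup>2 = 5 * (e\<^sup>2 + f\<^sup>2)"
      by (simp add: algebra_simps power2_eq_square)
    then have "(2 * e - f)\<^sup>2 + (2 * f + e)\<^sup>2 = 5 ^ Suc k" by (simp add: IH)
    moreover have "5 dvd (2 * e - f) - 2 * (2 * f + e)" "\<not> 5 dvd 2 * f + e"
      using IH(3,4) by presburger+
    moreover have "A = (2 * e - f) * a' - (2 * f + e) * b'" "B = (2 * e - f) * b' + (2 * f + e) * a'"
      by (simp_all add: AB IH(5,6) algebra_simps)
    moreover have "Suc k \<ge> 1" by simp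
    ultimately show ?thesis using IH(7) by blast
  qed
qed

subsection \<open>Negative Pell equations\<close>

text \<open>Descent by the unit p + q sqrt D of norm 1: while s >= p, dividing s + t sqrt D by it
  keeps the norm -1 and t > 0, and makes s smaller but not negative.\<close>

lemma negative_pell_induct:
  fixes D p q s t :: int
  assumes "D > 0" "p > 1" "q > 0" and pq: "p\<^sup>2 = D * q\<^sup>2 + 1"
    and "s \<ge> 0" "t > 0" "s\<^sup>2 + 1 = D * t\<^sup>2"
    and base: "\<And>s t. \<lbrakk>0 \<le> s; s < p; t > 0; s\<^sup>2 + 1 = D * t\<^sup>2\<rbrakk> \<Longrightarrow> P s t"
    and step: "\<And>s t. P s t \<Longrightarrow> P (p * s + D * q * t) (q * s + p * t)"
  shows "P s t"
  using assms(5-7)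
proof (induction "nat s" arbitrary: s t rule: less_induct)
  case less
  show ?case
  proof (cases "s < p")
    case True
    then show ?thesis using base less.prems by blast
  next
    case False
    \<comment> \<open>s' + t' sqrt D = (s + t sqrt D)(p - q sqrt D).\<close>
    define s' where "s' = p * s - D * q * t"
    define t' where "t' = p * t - q * s"
    \<comment> \<open>From D q^2 = p^2 - 1 and D t^2 = s^2 + 1. Both bounds in 0 <= s' < s follow by
      comparing this square with those of p s and (p - 1) s.\<close>
    have Dqt: "(D * q * t)\<^sup>2 = (p\<^sup>2 - 1) * (s\<^sup>2 + 1)"
      unfolding less.prems(3) pq by (simp add: algebra_simps power2_eq_square)
    have "p\<^sup>2 \<le> s\<^sup>2" using False \<open>p > 1\<close> by (intro power_mono) auto
    then have "(D * q * t)\<^sup>2 \<le> (p * s)\<^sup>2"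
      unfolding Dqt by (simp add: algebra_simps power_mult_distrib)
    then have s': "s' \<ge> 0"
      unfolding s'_def using power2_le_imp_le[of "D * q * t" "p * s"] \<open>p > 1\<close> less.prems by simp
    have "((p - 1) * s)\<^sup>2 < (D * q * t)\<^sup>2"
    proof -
      have "(p\<^sup>2 - 1) * (s\<^sup>2 + 1) - ((p - 1) * s)\<^sup>2 = 2 * (p - 1) * s\<^sup>2 + (p\<^sup>2 - 1)"
        by (simp add: algebra_simps power2_eq_square)
      moreover have "p\<^sup>2 > 1" using \<open>p > 1\<close> by (simp add: one_less_power)
      moreover have "2 * (p - 1) * s\<^sup>2 \<ge> 0" using \<open>p > 1\<close> by simp
      ultimately show ?thesis unfolding Dqt by linarith
    qed
    then have "(p - 1) * s < D * q * t"
      using power2_less_imp_less assms(1-3) less.prems by (smt (verit) mult_nonneg_nonneg)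
    then have s's: "s' < s" unfolding s'_def by (simp add: algebra_simps)
    have "(p * t)\<^sup>2 - (q * s)\<^sup>2 = t\<^sup>2 + q\<^sup>2 * (D * t\<^sup>2 - s\<^sup>2)"
      by (simp add: power_mult_distrib pq algebra_simps)
    also have "\<dots> = t\<^sup>2 + q\<^sup>2" using less.prems(3) by (simp add: algebra_simps flip: less.prems(3))
    also have "\<dots> > 0" using less.prems(2) by (simp add: add_pos_nonneg)
    finally have "q * s < p * t"
      using power2_less_imp_less[of "q * s" "p * t"] assms(2) less.prems by simp
    then have t': "t' > 0" unfolding t'_def by simp
    have "s'\<^sup>2 - D * t'\<^sup>2 = (p\<^sup>2 - D * q\<^sup>2) * (s\<^sup>2 - D * t\<^sup>2)"
      unfolding s'_def t'_def by (simp add: algebra_simps power2_eq_square)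
    also have "\<dots> = -1" using pq less.prems(3) by simp
    finally have "s'\<^sup>2 + 1 = D * t'\<^sup>2" by simp
    then have "P s' t'" using less.hyps[of s' t'] s' s's t' by auto
    then have "P (p * s' + D * q * t') (q * s' + p * t')" by (rule step)
    moreover have "p * s' + D * q * t' = (p\<^sup>2 - D * q\<^sup>2) * s" "q * s' + p * t' = (p\<^sup>2 - D * q\<^sup>2) * t"
      unfolding s'_def t'_def by (simp_all add: algebra_simps power2_eq_square)
    ultimately show ?thesis using pq by simp
  qed
qed

lemma linear_combination_mod:
  fixes a b s t m :: int
  shows "(a * s + b * t) mod m = (a * (s mod m) + b * (t mod m)) mod m"
  by (metis mod_add_eq mod_mult_right_eq)

text \<open>All solutions come from 2 + sqrt 5 by multiplying with 9 + 4 sqrt 5. The third, 682 +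
  305 sqrt 5, suggests the modulus 305 = 5 * 61. \<open>S\<close> is the orbit of (2, 1) modulo 305;
  in it a second entry divisible by 5 is already 0.\<close>

lemma negative_pell_5_dvd:
  fixes s t :: int
  assumes "s \<ge> 0" "t > 0" "s\<^sup>2 + 1 = 5 * t\<^sup>2" "5 dvd t"
  shows "61 dvd t"
proof -
  define S :: "(int \<times> int) set" where "S =
     {(2, 1), (38, 17), (72, 0), (38, 288), (2, 304),
      (303, 304), (267, 288), (233, 0), (267, 17), (303, 1)}"
  have closed: "\<forall>(a, b)\<in>S. ((9 * a + 5 * 4 * b) mod 305, (4 * a + 9 * b) mod 305) \<in> S"
    unfolding S_def by simp
  have "(s mod 305, t mod 305) \<in> S"
  proof (rule negative_pell_induct[where D = 5 and p = 9 and q = 4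
        and P = "\<lambda>s t. (s mod 305, t mod 305) \<in> S"])
    fix s t :: int
    assume st: "0 \<le> s" "s < 9" "t > 0" "s\<^sup>2 + 1 = 5 * t\<^sup>2"
    have "s\<^sup>2 \<le> 8\<^sup>2" using st by (intro power_mono) auto
    then have "t\<^sup>2 < 5\<^sup>2" using st by simp
    then have "t < 5" by (rule power2_less_imp_less) simp
    then have "t \<in> {1, 2, 3, 4}" using st(3) by simp presburger
    moreover have "s \<in> {0, 1, 2, 3, 4, 5, 6, 7, 8}"
      using st(1,2) by simp presburger
    ultimately have "s = 2 \<and> t = 1" using st(4) by (elim insertE) simp_all
    then show "(s mod 305, t mod 305) \<in> S" by (simp add: S_def)
  next
    fix s t :: int
    assume "(s mod 305, t mod 305) \<in> S"
    from bspec[OF closed this]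
    show "((9 * s + 5 * 4 * t) mod 305, (4 * s + 9 * t) mod 305) \<in> S"
      by (simp only: prod.case linear_combination_mod[symmetric])
  qed (use assms in simp_all)
  moreover have "\<forall>(a, b)\<in>S. b mod 5 = 0 \<longrightarrow> b = 0" unfolding S_def by simp
  ultimately have "(t mod 305) mod 5 = 0 \<longrightarrow> t mod 305 = 0" by fastforce
  then have "305 dvd t" using assms(4) by (simp add: mod_mod_cancel dvd_eq_mod_eq_0)
  then show ?thesis using dvd_trans[of 61 305 t] by simp
qed

text \<open>As for D = 5, now with start 3 + sqrt 10, unit 19 + 6 sqrt 10 and third solution 4443 +
  1405 sqrt 10, where 1405 = 5 * 281.\<close>

lemma negative_pell_10_dvd:
  fixes s t :: int
  assumes "s \<ge> 0" "t > 0" "s\<^sup>2 + 1 = 10 * t\<^sup>2" "5 dvd t"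
  shows "281 dvd t"
proof -
  define S :: "(int \<times> int) set" where "S =
     {(3, 1), (117, 37), (228, 0), (117, 1368), (3, 1404),
      (1402, 1404), (1288, 1368), (1177, 0), (1288, 37), (1402, 1)}"
  have closed: "\<forall>(a, b)\<in>S. ((19 * a + 10 * 6 * b) mod 1405, (6 * a + 19 * b) mod 1405) \<in> S"
    unfolding S_def by simp
  have "(s mod 1405, t mod 1405) \<in> S"
  proof (rule negative_pell_induct[where D = 10 and p = 19 and q = 6
        and P = "\<lambda>s t. (s mod 1405, t mod 1405) \<in> S"])
    fix s t :: int
    assume st: "0 \<le> s" "s < 19" "t > 0" "s\<^sup>2 + 1 = 10 * t\<^sup>2"
    have "s\<^sup>2 \<le> 18\<^sup>2" using st by (intro power_mono) auto
    then have "t\<^sup>2 < 6\<^sup>2" using st by simp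
    then have "t < 6" by (rule power2_less_imp_less) simp
    then have "t \<in> {1, 2, 3, 4, 5}" using st(3) by simp presburger
    moreover have "s \<in> {0, 1, 2, 3, 4, 5, 6, 7, 8, 9, 10, 11, 12, 13, 14, 15, 16, 17, 18}"
      using st(1,2) by simp presburger
    ultimately have "s = 3 \<and> t = 1" using st(4) by (elim insertE) simp_all
    then show "(s mod 1405, t mod 1405) \<in> S" by (simp add: S_def)
  next
    fix s t :: int
    assume "(s mod 1405, t mod 1405) \<in> S"
    from bspec[OF closed this]
    show "((19 * s + 10 * 6 * t) mod 1405, (6 * s + 19 * t) mod 1405) \<in> S"
      by (simp only: prod.case linear_combination_mod[symmetric])
  qed (use assms in simp_all)
  moreover have "\<forall>(a, b)\<in>S. b mod 5 = 0 \<longrightarrow> b = 0" unfolding S_def by simp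
  ultimately have "(t mod 1405) mod 5 = 0 \<longrightarrow> t mod 1405 = 0" by fastforce
  then have "1405 dvd t" using assms(4) by (simp add: mod_mod_cancel dvd_eq_mod_eq_0)
  then show ?thesis using dvd_trans[of 281 1405 t] by simp
qed

text \<open>The solution 7 + 5 sqrt 2 has a power of 5 as second entry, so the test is divisibility
  by 25. With start 1 + sqrt 2 and unit 3 + 2 sqrt 2, it first occurs at the eighth solution, t =
  195025 = 25 * 29 * 269; hence the modulus 725 = 25 * 29.\<close>

lemma negative_pell_2_dvd:
  fixes s t :: int
  assumes "s \<ge> 0" "t > 0" "s\<^sup>2 + 1 = 2 * t\<^sup>2" "25 dvd t"
  shows "29 dvd t"
proof -
  define S :: "(int \<times> int) set" where "S =
     {(1, 1), (7, 5), (41, 29), (239, 169), (668, 260), (144, 666),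
      (196, 111), (307, 0), (196, 614), (144, 59), (668, 465), (239, 556),
      (41, 696), (7, 720), (1, 724), (724, 724), (718, 720), (684, 696),
      (486, 556), (57, 465), (581, 59), (529, 614), (418, 0), (529, 111),
      (581, 666), (57, 260), (486, 169), (684, 29), (718, 5), (724, 1)}"
  have closed: "\<forall>(a, b)\<in>S. ((3 * a + 2 * 2 * b) mod 725, (2 * a + 3 * b) mod 725) \<in> S"
    unfolding S_def by simp
  have "(s mod 725, t mod 725) \<in> S"
  proof (rule negative_pell_induct[where D = 2 and p = 3 and q = 2
        and P = "\<lambda>s t. (s mod 725, t mod 725) \<in> S"])
    fix s t :: int
    assume st: "0 \<le> s" "s < 3" "t > 0" "s\<^sup>2 + 1 = 2 * t\<^sup>2"
    have "s\<^sup>2 \<le> 2\<^sup>2" using st by (intro power_mono) auto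
    then have "t\<^sup>2 < 3\<^sup>2" using st by simp
    then have "t < 3" by (rule power2_less_imp_less) simp
    then have "t \<in> {1, 2}" using st(3) by simp presburger
    moreover have "s \<in> {0, 1, 2}"
      using st(1,2) by simp presburger
    ultimately have "s = 1 \<and> t = 1" using st(4) by (elim insertE) simp_all
    then show "(s mod 725, t mod 725) \<in> S" by (simp add: S_def)
  next
    fix s t :: int
    assume "(s mod 725, t mod 725) \<in> S"
    from bspec[OF closed this]
    show "((3 * s + 2 * 2 * t) mod 725, (2 * s + 3 * t) mod 725) \<in> S"
      by (simp only: prod.case linear_combination_mod[symmetric])
  qed (use assms in simp_all)
  moreover have "\<forall>(a, b)\<in>S. b mod 25 = 0 \<longrightarrow> b = 0" unfolding S_def by simp
  ultimately have "(t mod 725) mod 25 = 0 \<longrightarrow> t mod 725 = 0" by fastforce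
  then have "725 dvd t" using assms(4) by (simp add: mod_mod_cancel dvd_eq_mod_eq_0)
  then show ?thesis using dvd_trans[of 29 725 t] by simp
qed

section \<open>When s^2 + 1 is a power of 5 or twice such a power\<close>

lemma not_dvd_power_five:
  fixes p :: int
  assumes "prime p" "\<not> p dvd 5"
  shows "\<not> p dvd 5 ^ m"
  using assms prime_dvd_power by blast

text \<open>For even k two consecutive integers would be squares, forcing s = 0. For k = 2m + 1, 5^m
  solves the Pell equation with D = 5, and m > 0 would make 61 divide a power of 5.\<close>

lemma square_plus_one_eq_power_five:
  fixes s :: int
  assumes "s \<ge> 0" "k \<ge> 1" "s\<^sup>2 + 1 = 5 ^ k"
  shows "s = 2"
proof (cases "even k")
  case True
  then obtain m where k: "k = 2 * m" by blast
  have eq: "s\<^sup>2 + 1 = (5 ^ m)\<^sup>2" using assms(3) by (simp add: k power_mult mult.commute)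
  then have "s\<^sup>2 < (5 ^ m)\<^sup>2" by linarith
  then have "s < 5 ^ m" by (rule power2_less_imp_less) simp
  then have "(s + 1)\<^sup>2 \<le> (5 ^ m)\<^sup>2" using assms(1) by (intro power_mono) auto
  then have "s = 0" using eq assms(1) by (simp add: power2_sum)
  then have "(5 :: int) ^ k = 1" using assms(3) by simp
  moreover have "(5 :: int) ^ k > 1" using assms(2) by (intro one_less_power) auto
  ultimately show ?thesis by simp
next
  case False
  then obtain m where k: "k = 2 * m + 1" by (elim oddE)
  have eq: "s\<^sup>2 + 1 = 5 * (5 ^ m)\<^sup>2" using assms(3) by (simp add: k power_mult mult.commute)
  show ?thesis
  proof (cases "m = 0")
    case True
    then have "s\<^sup>2 = 2\<^sup>2" using eq by simp
    then have "s = 2 \<or> s = - 2" by (simp only: power2_eq_iff)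
    then show ?thesis using assms(1) by auto
  next
    case False
    then have "(5 :: int) dvd 5 ^ m" by simp
    then have "(61 :: int) dvd 5 ^ m" using negative_pell_5_dvd[OF assms(1) _ eq] by simp
    then show ?thesis using not_dvd_power_five[of 61 m] by simp
  qed
qed

text \<open>Parity of k selects the Pell equation: D = 2 for k = 2m, where m = 1 gives 7 and 29
  refutes m >= 2; D = 10 for k = 2m + 1, where m = 0 gives 3 and 281 refutes m > 0.\<close>

lemma square_plus_one_eq_twice_power_five:
  fixes s :: int
  assumes "s \<ge> 0" "k \<ge> 1" "s\<^sup>2 + 1 = 2 * 5 ^ k"
  shows "s = 3 \<or> s = 7"
proof (cases "even k")
  case True
  then obtain m where k: "k = 2 * m" by blast
  have eq: "s\<^sup>2 + 1 = 2 * (5 ^ m)\<^sup>2" using assms(3) by (simp add: k power_mult mult.commute)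
  show ?thesis
  proof (cases "m = 1")
    case True
    then have "s\<^sup>2 = 7\<^sup>2" using eq by simp
    then have "s = 7 \<or> s = - 7" by (simp only: power2_eq_iff)
    then show ?thesis using assms(1) by auto
  next
    case False
    then have "2 \<le> m" using assms(2) k by simp
    then have "(5 :: int)\<^sup>2 dvd 5 ^ m" by (rule le_imp_power_dvd)
    then have "(29 :: int) dvd 5 ^ m" using negative_pell_2_dvd[OF assms(1) _ eq] by simp
    then show ?thesis using not_dvd_power_five[of 29 m] by simp
  qed
next
  case False
  then obtain m where k: "k = 2 * m + 1" by (elim oddE)
  have eq: "s\<^sup>2 + 1 = 10 * (5 ^ m)\<^sup>2" using assms(3) by (simp add: k power_mult mult.commute)
  show ?thesis
  proof (cases "m = 0")
    case True
    then have "s\<^sup>2 = 3\<^sup>2" using eq by simp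
    then have "s = 3 \<or> s = - 3" by (simp only: power2_eq_iff)
    then show ?thesis using assms(1) by auto
  next
    case False
    then have "(5 :: int) dvd 5 ^ m" by simp
    then have "(281 :: int) dvd 5 ^ m" using negative_pell_10_dvd[OF assms(1) _ eq] by simp
    then show ?thesis using not_dvd_power_five[of 281 m] by simp
  qed
qed

subsection \<open>Removing the unit square\<close>

text \<open>Up to sign z = 5w + 3, and the rotation (1, z) -> ((3 + 4z)/5, (3z - 4)/5) yields (4w +
  3, 3w + 1). A unit appears only for w = -1 or w = 0, that is |z| = 2 or |z| = 3.\<close>

lemma nonunit_by_rotation5:
  fixes y z :: int
  assumes "z mod 5 \<in> {2, 3}" "\<bar>y\<bar> \<noteq> 1" "\<bar>z\<bar> \<noteq> 2" "\<bar>z\<bar> \<noteq> 3"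
  shows "sum_of_three_nonunit_squares (1 + y\<^sup>2 + z\<^sup>2)"
proof -
  have "\<exists>w. z = 5 * w + 3 \<or> z = - (5 * w + 3)" using assms(1) by simp presburger
  then obtain w where w: "z = 5 * w + 3 \<or> z = - (5 * w + 3)" ..
  then have "z\<^sup>2 = (5 * w + 3)\<^sup>2" by (simp only: power2_eq_iff)
  then have "1 + y\<^sup>2 + z\<^sup>2 = y\<^sup>2 + (4 * w + 3)\<^sup>2 + (3 * w + 1)\<^sup>2"
    by (simp add: power2_eq_square algebra_simps)
  moreover have "\<bar>4 * w + 3\<bar> \<noteq> 1" "\<bar>3 * w + 1\<bar> \<noteq> 1" using w assms(3,4) by presburger+
  ultimately show ?thesis using assms(2) by (intro sum_of_three_nonunit_squaresI)
qed

text \<open>Reflection in (1, 1, 1) is integral on vectors whose coordinate sum is divisible by 3.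
  It is applied to (1, -1, 3t) and (1, 1, 3t + 1); the excluded values are those where a unit
  remains.\<close>

lemma nonunit_two_plus_square:
  fixes z :: int
  assumes "2 + z\<^sup>2 \<notin> {2, 3, 6, 11, 51}"
  shows "sum_of_three_nonunit_squares (2 + z\<^sup>2)"
proof -
  have z: "z \<notin> {0, 1, -1, 2, -2, 3, -3, 7, -7}" using assms by auto
  have "\<exists>t. z = 3 * t \<or> z = 3 * t + 1 \<or> z = - (3 * t + 1)" by presburger
  then obtain t where "z = 3 * t \<or> z = 3 * t + 1 \<or> z = - (3 * t + 1)" ..
  then consider "z = 3 * t" | "z = 3 * t + 1 \<or> z = - (3 * t + 1)" by blast
  then show ?thesis
  proof cases
    case 1
    then have "2 + z\<^sup>2 = (2 * t - 1)\<^sup>2 + (2 * t + 1)\<^sup>2 + t\<^sup>2"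
      by (simp add: power2_eq_square algebra_simps)
    moreover have "t \<noteq> 0" "t \<noteq> 1" "t \<noteq> -1" using 1 z by auto
    then have "\<bar>2 * t - 1\<bar> \<noteq> 1" "\<bar>2 * t + 1\<bar> \<noteq> 1" "\<bar>t\<bar> \<noteq> 1" by presburger+
    ultimately show ?thesis by (rule sum_of_three_nonunit_squaresI)
  next
    case 2
    then have "z\<^sup>2 = (3 * t + 1)\<^sup>2" by (simp only: power2_eq_iff)
    then have "2 + z\<^sup>2 = (2 * t + 1)\<^sup>2 + (2 * t + 1)\<^sup>2 + (t - 1)\<^sup>2"
      by (simp add: power2_eq_square algebra_simps)
    moreover have "t \<noteq> 0" "t \<noteq> -1" "t \<noteq> 2" using 2 z by auto
    then have "\<bar>2 * t + 1\<bar> \<noteq> 1" "\<bar>2 * t + 1\<bar> \<noteq> 1" "\<bar>t - 1\<bar> \<noteq> 1" by presburger+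
    ultimately show ?thesis by (rule sum_of_three_nonunit_squaresI)
  qed
qed

text \<open>The same reflection, applied to (1, 2, 3t) and (1, -2, 3t + 1).\<close>

lemma nonunit_five_plus_square:
  fixes y :: int
  assumes "5 + y\<^sup>2 \<notin> {5, 6, 14, 21, 30}"
  shows "sum_of_three_nonunit_squares (5 + y\<^sup>2)"
proof -
  have y: "y \<notin> {0, 1, -1, 3, -3, 4, -4, 5, -5}" using assms by auto
  \<comment> \<open>The sign of y is free; t <= 0 avoids t = 3, where t - 2 is a unit although 5 +
    9^2 is not excluded.\<close>
  have "\<exists>t. (t \<le> 0 \<and> (y = 3 * t \<or> y = - (3 * t))) \<or> y = 3 * t + 1 \<or> y = - (3 * t + 1)" by presburger
  then obtain t where "(t \<le> 0 \<and> (y = 3 * t \<or> y = - (3 * t))) \<or> y = 3 * t + 1 \<or> y = - (3 * t + 1)" ..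
  then consider "t \<le> 0" "y = 3 * t \<or> y = - (3 * t)" | "y = 3 * t + 1 \<or> y = - (3 * t + 1)" by blast
  then show ?thesis
  proof cases
    case 1
    then have "y\<^sup>2 = (3 * t)\<^sup>2" by (simp only: power2_eq_iff)
    then have "5 + y\<^sup>2 = (2 * t + 1)\<^sup>2 + (2 * t)\<^sup>2 + (t - 2)\<^sup>2"
      by (simp add: power2_eq_square algebra_simps)
    moreover have "t \<noteq> 0" "t \<noteq> -1" "t \<noteq> 1" "t \<noteq> 3" using 1 y by auto
    then have "\<bar>2 * t + 1\<bar> \<noteq> 1" "\<bar>2 * t\<bar> \<noteq> 1" "\<bar>t - 2\<bar> \<noteq> 1" by presburger+
    ultimately show ?thesis by (rule sum_of_three_nonunit_squaresI)
  next
    case 2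
    then have "y\<^sup>2 = (3 * t + 1)\<^sup>2" by (simp only: power2_eq_iff)
    then have "5 + y\<^sup>2 = (2 * t - 1)\<^sup>2 + (2 * t + 2)\<^sup>2 + (t + 1)\<^sup>2"
      by (simp add: power2_eq_square algebra_simps)
    moreover have "t \<noteq> 0" "t \<noteq> 1" "t \<noteq> -2" using 2 y by auto
    then have "\<bar>2 * t - 1\<bar> \<noteq> 1" "\<bar>2 * t + 2\<bar> \<noteq> 1" "\<bar>t + 1\<bar> \<noteq> 1" by presburger+
    ultimately show ?thesis by (rule sum_of_three_nonunit_squaresI)
  qed
qed

text \<open>The same reflection, applied to (1, 3, y) and (1, -3, y) with y = 3t - 1. If 3 divides
  y, no choice of signs makes the coordinate sum divisible by 3.\<close>

lemma nonunit_ten_plus_square: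
  fixes y :: int
  assumes "\<not> 3 dvd y" "10 + y\<^sup>2 \<notin> {11, 14, 26, 35}"
  shows "sum_of_three_nonunit_squares (10 + y\<^sup>2)"
proof -
  have y: "y \<notin> {1, -1, 2, -2, 4, -4, 5, -5}" using assms by auto
  have "\<exists>t. y = 3 * t - 1 \<or> y = - (3 * t - 1)" using assms(1) by presburger
  then obtain t where t: "y = 3 * t - 1 \<or> y = - (3 * t - 1)" ..
  then have "y\<^sup>2 = (3 * t - 1)\<^sup>2" by (simp only: power2_eq_iff)
  then have eq: "10 + y\<^sup>2 = (2 * t + 1)\<^sup>2 + (2 * t - 1)\<^sup>2 + (t - 3)\<^sup>2"
      "10 + y\<^sup>2 = (2 * t - 3)\<^sup>2 + (2 * t + 1)\<^sup>2 + (t + 1)\<^sup>2"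
    by (simp_all add: power2_eq_square algebra_simps)
  show ?thesis
  \<comment> \<open>For t = 4, y is 11 or -11 and t - 3 = 1, so the second identity takes
    over.\<close>
  proof (cases "t = 4")
    case True
    show ?thesis by (rule sum_of_three_nonunit_squaresI[OF eq(2)]) (simp_all add: True)
  next
    case False
    have "t \<noteq> 0" "t \<noteq> -1" "t \<noteq> 1" "t \<noteq> 2" using t y by auto
    then have "\<bar>2 * t + 1\<bar> \<noteq> 1" "\<bar>2 * t - 1\<bar> \<noteq> 1" "\<bar>t - 3\<bar> \<noteq> 1" using False by presburger+
    then show ?thesis by (rule sum_of_three_nonunit_squaresI[OF eq(1)])
  qed
qed

text \<open>Any representation 1 + s^2 = c^2 + d^2 gives 1 + (3c)^2 + (3d)^2. Multiples of 3 never
  have absolute value 1 or 2, so the rotation needs only c and d to be nonunits and one of them to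
  be 1 or -1 modulo 5.\<close>

lemma nonunit_ten_plus_nine_square_aux:
  fixes s :: int
  assumes "5 dvd 1 - 2 * s" "\<bar>s\<bar> \<noteq> 2" "\<bar>s\<bar> \<noteq> 3"
  shows "sum_of_three_nonunit_squares (10 + (3 * s)\<^sup>2)"
proof -
  have "\<not> 5 dvd s" using assms(1) by presburger
  then obtain k e f a b where k: "k \<ge> 1" "e\<^sup>2 + f\<^sup>2 = 5 ^ k" and ef: "5 dvd e - 2 * f" "\<not> 5 dvd f"
    and one: "e * a - f * b = 1" and s: "s = e * b + f * a" and ab: "\<not> 5 dvd a\<^sup>2 + b\<^sup>2"
    using gaussian_power_five_factor[OF assms(1)] by (metis (no_types))
  have "(e * a - f * b)\<^sup>2 + s\<^sup>2 = (e\<^sup>2 + f\<^sup>2) * (a\<^sup>2 + b\<^sup>2)"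
    unfolding s by (simp add: power2_eq_square algebra_simps)
  then have norm: "s\<^sup>2 + 1 = (a\<^sup>2 + b\<^sup>2) * 5 ^ k"
    unfolding one k(2) by (simp only: one_power2 mult.commute add.commute)
  consider "a\<^sup>2 + b\<^sup>2 = 1" | "a\<^sup>2 + b\<^sup>2 = 2" | "a\<^sup>2 + b\<^sup>2 \<noteq> 1" "a\<^sup>2 + b\<^sup>2 \<noteq> 2" by blast
  then show ?thesis
  proof cases
    case 1
    then have "\<bar>s\<bar> = 2" using norm k(1) by (intro square_plus_one_eq_power_five) auto
    then show ?thesis using assms(2) by simp
  next
    case 2
    then have "\<bar>s\<bar> = 3 \<or> \<bar>s\<bar> = 7"
      using norm k(1) by (intro square_plus_one_eq_twice_power_five) auto
    then have "s = 7 \<or> s = -7" using assms(3) by auto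
    \<comment> \<open>This is 451, the only value left by the two Pell cases that is not an
      exception.\<close>
    then have "10 + (3 * s)\<^sup>2 = 9\<^sup>2 + 3\<^sup>2 + 19\<^sup>2" by auto
    then show ?thesis by (rule sum_of_three_nonunit_squaresI) simp_all
  next
    case 3
    \<comment> \<open>c - di = (e + fi)(a - bi).\<close>
    define c where "c = e * a + f * b"
    define d where "d = e * b - f * a"
    have "\<not> 5 dvd e" using ef by presburger
    then have ef0: "e \<noteq> 0" "f \<noteq> 0" using ef(2) by auto
    have cd: "c\<^sup>2 + d\<^sup>2 = s\<^sup>2 + 1"
      unfolding norm c_def d_def k(2)[symmetric] by (simp add: power2_eq_square algebra_simps)
    have c1: "\<bar>c\<bar> \<noteq> 1"
    proof
      assume "\<bar>c\<bar> = 1"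
      then have "c\<^sup>2 = (e * a - f * b)\<^sup>2" by (simp add: one power2_eq_1_of_abs)
      then have "4 * (e * f * (a * b)) = 0"
        unfolding c_def by (simp add: power2_eq_square algebra_simps)
      then have "a = 0 \<or> b = 0" using ef0 by simp
      then have "a\<^sup>2 + b\<^sup>2 = 1"
      proof
        assume "a = 0"
        then have "b * (- f) = 1" using one by (simp add: mult.commute)
        then have "\<bar>b\<bar> = 1" by (metis abs_one abs_zmult_eq_1)
        then show ?thesis using \<open>a = 0\<close> by (simp add: power2_eq_1_of_abs)
      next
        assume "b = 0"
        then have "a * e = 1" using one by (simp add: mult.commute)
        then have "\<bar>a\<bar> = 1" by (metis abs_one abs_zmult_eq_1)
        then show ?thesis using \<open>b = 0\<close> by (simp add: power2_eq_1_of_abs)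
      qed
      then show False using 3 by simp
    qed
    have d1: "\<bar>d\<bar> \<noteq> 1"
    proof
      assume "\<bar>d\<bar> = 1"
      \<comment> \<open>The difference of these squares factors, and e^2 = f^2 is impossible because
        5^k is odd.\<close>
      then have "d\<^sup>2 = (e * a - f * b)\<^sup>2" by (simp add: one power2_eq_1_of_abs)
      then have "(e\<^sup>2 - f\<^sup>2) * (a\<^sup>2 - b\<^sup>2) = 0"
        unfolding d_def by (simp add: power2_eq_square algebra_simps)
      moreover have "e\<^sup>2 \<noteq> f\<^sup>2"
      proof
        assume "e\<^sup>2 = f\<^sup>2"
        then have "2 * f\<^sup>2 = 5 ^ k" using k(2) by simp
        then have "even ((5 :: int) ^ k)" by (metis dvd_triv_left)
        then show False by simp
      qed
      ultimately have "a\<^sup>2 = b\<^sup>2" by simp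
      then have "b = a \<or> b = - a" by (auto simp: power2_eq_iff)
      then have "a * (e - f) = 1 \<or> a * (e + f) = 1" using one by (auto simp: algebra_simps)
      then have "\<bar>a\<bar> = 1" by (metis abs_one abs_zmult_eq_1)
      then have "a\<^sup>2 + b\<^sup>2 = 2"
        using \<open>a\<^sup>2 = b\<^sup>2\<close> power2_eq_1_of_abs[of a] by simp
      then show False using 3 by simp
    qed
    have "5 dvd c\<^sup>2 + d\<^sup>2" unfolding cd norm using k(1) by simp
    moreover have "\<not> (5 dvd c \<and> 5 dvd d)"
    proof
      assume "5 dvd c \<and> 5 dvd d"
      then obtain c' d' where "c = 5 * c'" "d = 5 * d'" by (auto elim!: dvdE)
      moreover obtain g where "e = 2 * f + 5 * g" using ef(1) by (auto elim!: dvdE simp: algebra_simps)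
      \<comment> \<open>As e = 2f modulo 5, c = f (2a + b); so 5 would divide a - 2b and thus a^2 +
        b^2.\<close>
      ultimately have "f * (2 * a + b) = 5 * (c' - g * a)"
        unfolding c_def by (simp add: algebra_simps)
      then have "5 dvd f * (2 * a + b)" by simp
      moreover have "prime (5 :: int)" by simp
      ultimately have "5 dvd 2 * a + b" using ef(2) by (metis prime_dvd_mult_iff)
      then have "5 dvd a - 2 * b" by presburger
      then show False using ab five_dvd_sum_two_squares_iff by blast
    qed
    ultimately have "c mod 5 \<in> {1, 4} \<or> d mod 5 \<in> {1, 4}"
      using sum_two_squares_residues_mod5 by blast
    then have "(3 * c) mod 5 \<in> {2, 3} \<or> (3 * d) mod 5 \<in> {2, 3}" by simp presburger
    moreover have "10 + (3 * s)\<^sup>2 = 1 + (3 * c)\<^sup>2 + (3 * d)\<^sup>2"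
      "10 + (3 * s)\<^sup>2 = 1 + (3 * d)\<^sup>2 + (3 * c)\<^sup>2"
      using cd by (simp_all add: power_mult_distrib)
    moreover have "\<bar>3 * c\<bar> \<noteq> 1" "\<bar>3 * c\<bar> \<noteq> 2" "\<bar>3 * c\<bar> \<noteq> 3" "\<bar>3 * d\<bar> \<noteq> 1" "\<bar>3 * d\<bar> \<noteq> 2" "\<bar>3 * d\<bar> \<noteq> 3"
      using c1 d1 by presburger+
    ultimately show ?thesis
      using nonunit_by_rotation5[of "3 * c" "3 * d"] nonunit_by_rotation5[of "3 * d" "3 * c"] by argo
  qed
qed

lemma nonunit_ten_plus_nine_square:
  fixes s :: int
  assumes "5 dvd s\<^sup>2 + 1" "10 + (3 * s)\<^sup>2 \<notin> {46, 91}"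
  shows "sum_of_three_nonunit_squares (10 + (3 * s)\<^sup>2)"
proof -
  have "5 dvd 1 - 2 * s \<or> 5 dvd 1 - 2 * (- s)"
    using assms(1) five_dvd_sum_two_squares_iff[of 1 s] by (simp add: add.commute)
  moreover have "s \<notin> {2, -2, 3, -3}" using assms(2) by auto
  then have "\<bar>s\<bar> \<noteq> 2" "\<bar>s\<bar> \<noteq> 3" by auto
  ultimately show ?thesis
    using nonunit_ten_plus_nine_square_aux[of s] nonunit_ten_plus_nine_square_aux[of "- s"] by auto
qed

text \<open>The reflection lemmas also exclude 2, 3, 5, 14, 30 and 35, but none of these is 1 modulo
  5.\<close>

lemma nonunit_one_plus_two_squares:
  fixes y z :: int
  assumes y: "y mod 5 \<in> {1, 4}" and z: "z mod 5 \<in> {2, 3}"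
    and n: "1 + y\<^sup>2 + z\<^sup>2 \<notin> {6, 11, 21, 26, 46, 51, 91}"
  shows "sum_of_three_nonunit_squares (1 + y\<^sup>2 + z\<^sup>2)"
proof -
  have "5 dvd y\<^sup>2 + z\<^sup>2" using y z unfolding five_dvd_sum_two_squares_iff by simp presburger
  then have n5: "(1 + y\<^sup>2 + z\<^sup>2) mod 5 = 1" by presburger
  consider "\<bar>y\<bar> = 1" | "\<bar>z\<bar> = 2" | "\<bar>z\<bar> = 3" | "\<bar>y\<bar> \<noteq> 1" "\<bar>z\<bar> \<noteq> 2" "\<bar>z\<bar> \<noteq> 3" by blast
  then show ?thesis
  proof cases
    case 1
    then have eq: "1 + y\<^sup>2 + z\<^sup>2 = 2 + z\<^sup>2" by (simp add: power2_eq_1_of_abs)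
    then have "2 + z\<^sup>2 \<notin> {2, 3, 6, 11, 51}" using n n5 by auto
    then show ?thesis unfolding eq by (rule nonunit_two_plus_square)
  next
    case 2
    then have "z = 2 \<or> z = - 2" by auto
    then have eq: "1 + y\<^sup>2 + z\<^sup>2 = 5 + y\<^sup>2" by auto
    then have "5 + y\<^sup>2 \<notin> {5, 6, 14, 21, 30}" using n n5 by auto
    then show ?thesis unfolding eq by (rule nonunit_five_plus_square)
  next
    case 3
    then have "z = 3 \<or> z = - 3" by auto
    then have eq: "1 + y\<^sup>2 + z\<^sup>2 = 10 + y\<^sup>2" by auto
    show ?thesis
    proof (cases "3 dvd y")
      case True
      then obtain s where s: "y = 3 * s" by blast
      have "(10 + 9 * s\<^sup>2) mod 5 = 1" using n5 unfolding eq by (simp add: s power_mult_distrib)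
      then have "5 dvd s\<^sup>2 + 1" by presburger
      moreover have "10 + (3 * s)\<^sup>2 \<notin> {46, 91}" using n unfolding eq s[symmetric] by auto
      ultimately show ?thesis unfolding eq unfolding s by (rule nonunit_ten_plus_nine_square)
    next
      case False
      moreover have "10 + y\<^sup>2 \<notin> {11, 14, 26, 35}" using n n5 unfolding eq by auto
      ultimately show ?thesis unfolding eq by (rule nonunit_ten_plus_square)
    qed
  next
    case 4
    then show ?thesis using z by (intro nonunit_by_rotation5)
  qed
qed

theorem theorem2p9:
  fixes n :: int
  assumes "n > 0"
    and "[n = 1] (mod 5)"
    and "sum_of_three_squares n"
  shows "sum_of_three_nonunit_squares n \<longleftrightarrow> n \<notin> {1, 6, 11, 21, 26, 46, 51, 91}"
proof
  assume "sum_of_three_nonunit_squares n"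
  then show "n \<notin> {1, 6, 11, 21, 26, 46, 51, 91}" using not_sum_of_three_nonunit_squares by blast
next
  assume n: "n \<notin> {1, 6, 11, 21, 26, 46, 51, 91}"
  obtain x y z :: int where xyz: "n = x\<^sup>2 + y\<^sup>2 + z\<^sup>2"
    using assms(3) unfolding sum_of_three_squares_def by blast
  show "sum_of_three_nonunit_squares n"
  proof (cases "\<bar>x\<bar> = 1 \<or> \<bar>y\<bar> = 1 \<or> \<bar>z\<bar> = 1")
    case False
    then show ?thesis using sum_of_three_nonunit_squaresI[OF xyz] by blast
  next
    case True
    have "\<exists>u v :: int. n = 1 + (u\<^sup>2 + v\<^sup>2)"
      using True
    proof (elim disjE)
      assume "\<bar>x\<bar> = 1"
      then show ?thesis using xyz power2_eq_1_of_abs[of x] by (intro exI[of _ y] exI[of _ z]) simp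
    next
      assume "\<bar>y\<bar> = 1"
      then show ?thesis using xyz power2_eq_1_of_abs[of y] by (intro exI[of _ x] exI[of _ z]) simp
    next
      assume "\<bar>z\<bar> = 1"
      then show ?thesis using xyz power2_eq_1_of_abs[of z] by (intro exI[of _ x] exI[of _ y]) simp
    qed
    then obtain u v :: int where uv: "n = 1 + (u\<^sup>2 + v\<^sup>2)" by blast
    \<comment> \<open>Excluding n = 1 makes u + vi nonzero, so common factors of 5 can be
      removed.\<close>
    then have "u\<^sup>2 + v\<^sup>2 \<noteq> 0" using n by auto
    moreover have "u\<^sup>2 + v\<^sup>2 \<ge> 0" by simp
    ultimately have "u\<^sup>2 + v\<^sup>2 > 0" by linarith
    then obtain a b :: int where ab: "a\<^sup>2 + b\<^sup>2 = u\<^sup>2 + v\<^sup>2" "\<not> (5 dvd a \<and> 5 dvd b)"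
      using sum_two_squares_not_both_dvd5 by blast
    have "5 dvd n - 1" using assms(2) by (simp add: cong_iff_dvd_diff)
    then have "5 dvd a\<^sup>2 + b\<^sup>2" by (simp add: uv ab(1))
    then have "a mod 5 \<in> {1, 4} \<and> b mod 5 \<in> {2, 3} \<or> b mod 5 \<in> {1, 4} \<and> a mod 5 \<in> {2, 3}"
      using ab(2) by (rule sum_two_squares_residues_mod5)
    moreover have "n = 1 + a\<^sup>2 + b\<^sup>2" "n = 1 + b\<^sup>2 + a\<^sup>2" using uv ab(1) by simp_all
    ultimately show ?thesis
      using n nonunit_one_plus_two_squares by (metis insert_iff)
  qed
qed

end
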